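(* Let $D$ be an oriented path. If $\mathcal{C}(P_3,D)>0$, then $D$ is locally tournament anti-Sidorenko (LTAS). If $\mathcal{C}(P_3,D)<0$, then $D$ is locally tournament Sidorenko (LTS).
   Context: A weighted tournament on $n$ vertices is a function $A:[n]^2\to[0,1]$ with $A(x,y)+A(y,x)=1$ for all $x,y$ (so $A(x,x)=1/2$). For a digraph $D$, $t_D(A)=n^{-v(D)}\sum_{\phi:V(D)\to[n]}\prod_{(x,y)\in E(D)}A(\phi(x),\phi(y))$. Write $A=\frac12J+B$ with $J$ the all-ones matrix and $B$ skew-symmetric, and let $\lambda_{\max}(B)$ be the largest modulus of an eigenvalue of $B$. $D$ is LTS if there is $\varepsilon=\varepsilon(D)>0$ such that for every $n$ and every weighted tournament $A=\frac12J+B$ on $n$ vertices with $\lambda_{\max}(B)\le\varepsilon n$ one has $t_D(A)\ge2^{-e(D)}$; it is LTAS if there is such an $\varepsilon$ with $t_D(A)\le2^{-e(D)}$ for all such $A$. An oriented path is an orientation of a finite path. $P_3$ is the directed path $\rightarrow\rightarrow$ on 3 vertices. $\mathcal{C}(P_3,D)$ is the signed count of copies of $P_3$ in $D$: the sum, over all two-edge subpaths of $D$, of $+1$ if the two edges point in the same direction along the path ($\rightarrow\rightarrow$ or $\leftarrow\leftarrow$) and $-1$ otherwise ($\rightarrow\leftarrow$ or $\leftarrow\rightarrow$). *)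

theory Defs
  imports
    "Graph_Theory.Pair_Digraph"
    "Jordan_Normal_Form.Spectral_Radius"
    "HOL-Library.FuncSet"
begin

definition oriented_path :: "'a pair_pre_digraph \<Rightarrow> bool" where
  "oriented_path D \<longleftrightarrow>
     (\<exists>xs (forward :: nat \<Rightarrow> bool). xs \<noteq> [] \<and> distinct xs \<and> pverts D = set xs \<and>
        parcs D = {if forward i then (xs ! i, xs ! Suc i) else (xs ! Suc i, xs ! i) | i.
                     Suc i < length xs})"

text \<open>A two-edge subpath on the (unoriented) path \<open>u - v - w\<close> is represented by its set of
  two arcs, so that it is counted once, although it can be traversed from either end.\<close>

definition two_edge_subpaths :: "'a pair_pre_digraph \<Rightarrow> ('a \<times> 'a) set set" where
  "two_edge_subpaths D =
     {{e, f} | e f u v w. distinct [u, v, w] \<and>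
        e \<in> parcs D \<inter> {(u, v), (v, u)} \<and> f \<in> parcs D \<inter> {(v, w), (w, v)}}"

definition P3_sign :: "('a \<times> 'a) set \<Rightarrow> int" where
  "P3_sign p = (if \<exists>e\<in>p. \<exists>f\<in>p. snd e = fst f then 1 else - 1)"

definition P3_signed_count :: "'a pair_pre_digraph \<Rightarrow> int" where
  "P3_signed_count D = (\<Sum>p\<in>two_edge_subpaths D. P3_sign p)"

text \<open>The vertices of a weighted tournament on \<open>n\<close> vertices are \<open>0, \<dots>, n - 1\<close>.\<close>

definition weighted_tournament :: "nat \<Rightarrow> real mat \<Rightarrow> bool" where
  "weighted_tournament n A \<longleftrightarrow> A \<in> carrier_mat n n \<and>
     (\<forall>x<n. \<forall>y<n. 0 \<le> A $$ (x, y) \<and> A $$ (x, y) \<le> 1 \<and> A $$ (x, y) + A $$ (y, x) = 1)"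

definition hom_density :: "'a pair_pre_digraph \<Rightarrow> nat \<Rightarrow> real mat \<Rightarrow> real" where
  "hom_density D n A =
     (\<Sum>\<phi>\<in>pverts D \<rightarrow>\<^sub>E {..<n}. \<Prod>(x, y)\<in>parcs D. A $$ (\<phi> x, \<phi> y)) / real n ^ card (pverts D)"

definition all_ones_mat :: "nat \<Rightarrow> real mat" where
  "all_ones_mat n = mat n n (\<lambda>_. 1)"

text \<open>The eigenvalues of a real skew-symmetric matrix are purely imaginary, so they have to be
  taken over the complex numbers.\<close>

definition lambda_max :: "real mat \<Rightarrow> real" where
  "lambda_max B = spectral_radius (map_mat complex_of_real B)"

text \<open>The matrix \<open>B\<close> below is automatically skew-symmetric. The case \<open>n = 0\<close> is excluded, as there
  is then neither a homomorphism density nor an eigenvalue.\<close>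

definition locally_tournament_Sidorenko :: "'a pair_pre_digraph \<Rightarrow> bool" where
  "locally_tournament_Sidorenko D \<longleftrightarrow>
     (\<exists>\<epsilon>>0. \<forall>n>0. \<forall>A. \<forall>B\<in>carrier_mat n n.
        weighted_tournament n A \<longrightarrow> A = (1 / 2) \<cdot>\<^sub>m all_ones_mat n + B \<longrightarrow>
        lambda_max B \<le> \<epsilon> * real n \<longrightarrow>
        hom_density D n A \<ge> 1 / 2 ^ card (parcs D))"

definition locally_tournament_anti_Sidorenko :: "'a pair_pre_digraph \<Rightarrow> bool" where
  "locally_tournament_anti_Sidorenko D \<longleftrightarrow>
     (\<exists>\<epsilon>>0. \<forall>n>0. \<forall>A. \<forall>B\<in>carrier_mat n n.
        weighted_tournament n A \<longrightarrow> A = (1 / 2) \<cdot>\<^sub>m all_ones_mat n + B \<longrightarrow>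
        lambda_max B \<le> \<epsilon> * real n \<longrightarrow>
        hom_density D n A \<le> 1 / 2 ^ card (parcs D))"

end

theory Submission
  imports Defs "HOL-Analysis.Convex"
begin

text \<open>Put \<open>T = B / n\<close> and let \<open>\<beta>\<^sub>k\<close> be the mean of \<open>T\<^sup>k 1\<close>. Expanding the product over the edges of
  a path with \<open>m\<close> edges expresses its density as a polynomial in the \<open>\<beta>\<^sub>k\<close>. By skew-symmetry
  \<open>\<beta>\<^sub>1 = 0\<close> and \<open>\<beta>\<^sub>2 = - q\<close>, where \<open>q\<close> is the mean square of \<open>T 1\<close>, so the density is
  \<open>1 / 2^m - 4 / 2^m * C * q\<close> with \<open>C\<close> the signed count, up to products of several moments and
  moments of order at least 3. If the spectral radius of \<open>T\<close> is less than \<open>r\<close>, then these are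
  \<open>O(r q)\<close>: the squared norms \<open>a\<^sub>k\<close> of \<open>T\<^sup>k 1\<close> form a log-convex sequence with
  \<open>a\<^sub>k = O(r^(2k))\<close>, which forces \<open>a\<^sub>k\<^sub>+\<^sub>1 \<le> r\<^sup>2 a\<^sub>k\<close> for every \<open>k\<close>. So for small \<open>r\<close> the
  sign of \<open>C\<close> decides.\<close>

subsection \<open>Expansion of path densities in moments\<close>

definition avg :: "nat \<Rightarrow> (nat \<Rightarrow> real) \<Rightarrow> real" where
  "avg n f = (\<Sum>x<n. f x) / real n"

lemma avg_cong: "(\<And>x. x < n \<Longrightarrow> f x = g x) \<Longrightarrow> avg n f = avg n g"
  by (simp add: avg_def)

lemma avg_add: "avg n (\<lambda>x. f x + g x) = avg n f + avg n g"
  by (simp add: avg_def sum.distrib add_divide_distrib)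

lemma avg_cmult: "avg n (\<lambda>x. c * f x) = c * avg n f"
  by (simp add: avg_def sum_distrib_left)

lemma avg_sum: "avg n (\<lambda>x. \<Sum>i\<in>I. f i x) = (\<Sum>i\<in>I. avg n (f i))"
  unfolding avg_def sum_divide_distrib[symmetric] by (subst sum.swap) (rule refl)

lemma avg_mono: "(\<And>x. x < n \<Longrightarrow> f x \<le> g x) \<Longrightarrow> avg n f \<le> avg n g"
  by (auto simp: avg_def intro!: divide_right_mono sum_mono)

lemma avg_const: "n > 0 \<Longrightarrow> avg n (\<lambda>_. c) = c"
  by (simp add: avg_def)

lemma avg_swap: "avg n (\<lambda>x. avg n (f x)) = avg n (\<lambda>y. avg n (\<lambda>x. f x y))"
  unfolding avg_def sum_divide_distrib[symmetric] by (subst sum.swap) (rule refl)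

lemma avg_Cauchy_Schwarz:
  "(avg n (\<lambda>x. f x * g x))\<^sup>2 \<le> avg n (\<lambda>x. (f x)\<^sup>2) * avg n (\<lambda>x. (g x)\<^sup>2)"
  using Cauchy_Schwarz_ineq_sum[of f g "{..<n}"]
  by (simp add: avg_def power_divide divide_right_mono power2_eq_square[of "real n"])

lemma sum_lessThan_add:
  fixes f :: "nat \<Rightarrow> real"
  shows "(\<Sum>k<m + n. f k) = (\<Sum>k<m. f k) + (\<Sum>k<n. f (m + k))"
  by (induction n) auto

text \<open>This is \<open>T^k 1\<close>; \<open>avg\<close> in place of a sum supplies the factor
  \<open>1 / n\<close> in \<open>T = B / n\<close>.\<close>

primrec walk :: "nat \<Rightarrow> (nat \<Rightarrow> nat \<Rightarrow> real) \<Rightarrow> nat \<Rightarrow> nat \<Rightarrow> real" where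
  "walk n B 0 x = 1"
| "walk n B (Suc k) x = avg n (\<lambda>y. B x y * walk n B k y)"

text \<open>The coefficient of \<open>T\<^sup>k 1\<close> in \<open>path_fun n B ss\<close>, when \<open>T = B / n\<close> has the moments \<open>\<beta>\<close>.\<close>

primrec coef :: "(nat \<Rightarrow> real) \<Rightarrow> real list \<Rightarrow> nat \<Rightarrow> real" where
  "coef \<beta> [] k = (if k = 0 then 1 else 0)"
| "coef \<beta> (s # ss) k =
     (case k of 0 \<Rightarrow> (\<Sum>j\<le>length ss. coef \<beta> ss j * \<beta> j) / 2 | Suc j \<Rightarrow> s * coef \<beta> ss j)"

text \<open>Taking an arbitrary sequence \<open>\<beta>\<close> in place of the moments of a kernel
  lets the estimates depend on the sizes of the moments alone.\<close>

definition path_total :: "(nat \<Rightarrow> real) \<Rightarrow> real list \<Rightarrow> real" where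
  "path_total \<beta> ss = (\<Sum>j\<le>length ss. coef \<beta> ss j * \<beta> j)"

text \<open>Each sign is \<open>1\<close> for an edge traversed forwards and \<open>- 1\<close> for one traversed backwards.\<close>

primrec path_fun :: "nat \<Rightarrow> (nat \<Rightarrow> nat \<Rightarrow> real) \<Rightarrow> real list \<Rightarrow> nat \<Rightarrow> real" where
  "path_fun n B [] x = 1"
| "path_fun n B (s # ss) x = avg n (\<lambda>y. (1 / 2 + s * B x y) * path_fun n B ss y)"

text \<open>Prepending an edge of sign \<open>s\<close> sends a function \<open>f\<close> to
  \<open>avg n f / 2 + s * T f\<close>. The mean feeds the constant coefficient and \<open>T\<close>
  shifts the other indices up by one, which is the recursion of \<open>coef\<close>.\<close>

lemma path_fun_expansion:
  "path_fun n B ss x = (\<Sum>k\<le>length ss. coef (\<lambda>k. avg n (walk n B k)) ss k * walk n B k x)"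
proof (induction ss arbitrary: x)
  case Nil
  show ?case by simp
next
  case (Cons s ss)
  let ?c = "coef (\<lambda>k. avg n (walk n B k))"
  have "path_fun n B (s # ss) x =
      avg n (\<lambda>y. (1 / 2) * path_fun n B ss y + s * (B x y * path_fun n B ss y))"
    by (simp add: algebra_simps)
  also have "\<dots> = (1 / 2) * avg n (path_fun n B ss) + s * avg n (\<lambda>y. B x y * path_fun n B ss y)"
    by (simp only: avg_add avg_cmult)
  also have "avg n (path_fun n B ss) = (\<Sum>k\<le>length ss. ?c ss k * avg n (walk n B k))"
    using Cons by (simp add: avg_sum avg_cmult cong: avg_cong)
  also have "avg n (\<lambda>y. B x y * path_fun n B ss y) =
      avg n (\<lambda>y. \<Sum>k\<le>length ss. ?c ss k * (B x y * walk n B k y))"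
    by (simp add: Cons sum_distrib_left mult_ac)
  also have "\<dots> = (\<Sum>k\<le>length ss. ?c ss k * walk n B (Suc k) x)"
    by (simp only: avg_sum avg_cmult walk.simps)
  finally show ?case
    by (simp add: sum.atMost_Suc_shift sum_distrib_left mult_ac del: sum.atMost_Suc walk.simps(2))
qed

corollary avg_path_fun: "avg n (path_fun n B ss) = path_total (\<lambda>k. avg n (walk n B k)) ss"
  by (simp add: path_fun_expansion avg_sum avg_cmult path_total_def cong: avg_cong)

lemma coef_Cons_0: "coef \<beta> (s # ss) 0 = path_total \<beta> ss / 2"
  by (simp add: path_total_def)

lemma coef_eq_0: "k > length ss \<Longrightarrow> coef \<beta> ss k = 0"
  by (induction ss arbitrary: k) (auto split: nat.split)

text \<open>The new constant coefficient is half of a sum of \<open>Suc m\<close> terms of size at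
  most \<open>fact m\<close>; the others are only shifted and signed. A crude bound suffices, since
  \<open>r\<close> may be small in terms of the length.\<close>

lemma abs_coef_le:
  assumes "\<And>k. \<bar>\<beta> k\<bar> \<le> 1" "set ss \<subseteq> {-1, 1}"
  shows "\<bar>coef \<beta> ss k\<bar> \<le> fact (length ss)"
  using assms(2)
proof (induction ss arbitrary: k)
  case Nil
  show ?case by simp
next
  case (Cons s ss)
  let ?m = "length ss"
  have IH: "\<bar>coef \<beta> ss j\<bar> \<le> fact ?m" for j
    using Cons by simp
  show ?case
  proof (cases k)
    case 0
    have "\<bar>\<Sum>j\<le>?m. coef \<beta> ss j * \<beta> j\<bar> \<le> (\<Sum>j\<le>?m. \<bar>coef \<beta> ss j * \<beta> j\<bar>)"
      by (rule sum_abs)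
    also have "\<dots> \<le> (\<Sum>j\<le>?m. fact ?m * 1)"
      unfolding abs_mult by (intro sum_mono mult_mono IH assms) auto
    finally have "\<bar>\<Sum>j\<le>?m. coef \<beta> ss j * \<beta> j\<bar> \<le> fact (Suc ?m)"
      by (simp add: algebra_simps)
    then show ?thesis
      using 0 by simp
  next
    case (Suc j)
    have "\<bar>s\<bar> = 1"
      using Cons.prems by auto
    moreover have "(fact ?m :: real) \<le> fact (Suc ?m)"
      by (rule fact_mono) auto
    ultimately show ?thesis
      using Suc IH[of j] by (simp add: abs_mult del: fact_Suc)
  qed
qed

section \<open>Second-order estimate of the path polynomial\<close>

fun turns :: "real list \<Rightarrow> real" where
  "turns (s # s' # ss) = s * s' + turns (s' # ss)"
| "turns _ = 0"

text \<open>Here \<open>q\<close> stands for the mean square of \<open>T 1\<close> and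
  \<open>r\<close> for a bound on the spectral radius of \<open>T\<close>. The condition
  \<open>q \<le> r\<close> makes errors of order \<open>q * q\<close> as small as
  \<open>r * q\<close>.\<close>

locale small_moments =
  fixes \<beta> :: "nat \<Rightarrow> real" and q r :: real
  assumes q: "0 \<le> q" "q \<le> r" and r: "r \<le> 1"
    and \<beta>0: "\<beta> 0 = 1" and \<beta>1: "\<beta> 1 = 0" and \<beta>2: "\<beta> 2 = - q"
    and \<beta>_ge_3: "k \<ge> 3 \<Longrightarrow> \<bar>\<beta> k\<bar> \<le> r * q"
begin

lemma abs_moment_le:
  assumes "k > 0"
  shows "\<bar>\<beta> k\<bar> \<le> q"
proof -
  have "r * q \<le> q"
    using q r by (intro mult_left_le_one_le) auto
  moreover have "k = 1 \<or> k = 2 \<or> k \<ge> 3"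
    using assms by auto
  ultimately show ?thesis
    using q \<beta>1 \<beta>2 \<beta>_ge_3[of k] by auto
qed

lemma abs_moment_le_1: "\<bar>\<beta> k\<bar> \<le> 1"
  using abs_moment_le[of k] q r \<beta>0 by (cases "k = 0") auto

text \<open>It serves twice: with cutoff 1 and \<open>e = q\<close> for the constant coefficient,
  and with cutoff 3 and \<open>e = r * q\<close> for the second-order term.\<close>

lemma path_total_approx_tail:
  assumes ss: "set ss \<subseteq> {-1, 1}" and d: "\<And>k. k \<ge> d \<Longrightarrow> \<bar>\<beta> k\<bar> \<le> e"
  shows "\<bar>path_total \<beta> ss - (\<Sum>k<d. coef \<beta> ss k * \<beta> k)\<bar> \<le> fact (Suc (length ss)) * e"
proof -
  let ?m = "length ss"
  have e: "e \<ge> 0"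
    using d[of d] by linarith
  \<comment> \<open>Padding with vanishing coefficients allows the split at \<open>d\<close> even
    when the list is shorter than \<open>d\<close>.\<close>
  have "path_total \<beta> ss = (\<Sum>k<d + Suc ?m. coef \<beta> ss k * \<beta> k)"
    unfolding path_total_def by (intro sum.mono_neutral_left) (auto simp: coef_eq_0)
  also have "\<dots> = (\<Sum>k<d. coef \<beta> ss k * \<beta> k) + (\<Sum>k<Suc ?m. coef \<beta> ss (d + k) * \<beta> (d + k))"
    by (rule sum_lessThan_add)
  finally have "\<bar>path_total \<beta> ss - (\<Sum>k<d. coef \<beta> ss k * \<beta> k)\<bar> =
      \<bar>\<Sum>k<Suc ?m. coef \<beta> ss (d + k) * \<beta> (d + k)\<bar>"
    by simp
  also have "\<dots> \<le> (\<Sum>k<Suc ?m. \<bar>coef \<beta> ss (d + k) * \<beta> (d + k)\<bar>)"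
    by (rule sum_abs)
  also have "\<dots> \<le> (\<Sum>k<Suc ?m. fact ?m * e)"
    unfolding abs_mult
    by (intro sum_mono mult_mono abs_coef_le[OF abs_moment_le_1 ss] d) auto
  also have "\<dots> = fact (Suc ?m) * e"
    by (simp add: algebra_simps)
  finally show ?thesis .
qed

text \<open>Each prepended edge halves the constant coefficient, up to half a tail of order
  \<open>q\<close>. The inherited error and the tail obey the same bound, so half their sum obeys it
  again.\<close>

lemma coef_0_approx:
  assumes "set ss \<subseteq> {-1, 1}"
  shows "\<bar>coef \<beta> ss 0 - 1 / 2 ^ length ss\<bar> \<le> fact (Suc (length ss)) * q"
  using assms
proof (induction ss)
  case Nil
  show ?case using q by simp
next
  case (Cons s ss)
  have "\<bar>path_total \<beta> ss - coef \<beta> ss 0\<bar> \<le> fact (Suc (length ss)) * q"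
    using path_total_approx_tail[of ss 1 q] abs_moment_le Cons.prems \<beta>0 by simp
  then have "\<bar>coef \<beta> (s # ss) 0 - 1 / 2 ^ length (s # ss)\<bar> \<le> fact (Suc (length ss)) * q"
    using Cons.IH Cons.prems unfolding coef_Cons_0 by (simp del: fact_Suc)
  also have "\<dots> \<le> fact (Suc (Suc (length ss))) * q"
    using q by (intro mult_right_mono fact_mono) auto
  finally show ?case by simp
qed

text \<open>Error bookkeeping for one more edge: \<open>t\<close> and \<open>a\<close> are the exact
  and approximate totals of the shorter path, \<open>t'\<close> and \<open>a'\<close> those of the
  longer one, \<open>c\<close> and \<open>d\<close> the new second-order terms. The inherited error
  is halved, so each of the three errors is at most \<open>f2 * e\<close>.\<close>

lemma approx_combine:
  fixes t t' :: real
  assumes "\<bar>c - d\<bar> \<le> e0" "\<bar>t - a\<bar> \<le> 4 * f1 * e" "e0 \<le> f2 * e" "2 * f1 * e \<le> f2 * e"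
    "a' = a / 2 - d" "\<bar>t' - (t / 2 - c)\<bar> \<le> f2 * e"
  shows "\<bar>t' - a'\<bar> \<le> 4 * f2 * e"
proof -
  have "t' - a' = (t' - (t / 2 - c)) + (t - a) / 2 - (c - d)"
    using assms(5) by (simp add: field_simps)
  then show ?thesis
    using assms by linarith
qed

text \<open>Only the turn at the front is new. It contributes \<open>- q\<close> times the
  coefficient of \<open>T^2 1\<close>, which is \<open>s * s'\<close> times the constant coefficient
  of the path with two edges fewer. Those two missing halvings give the factor 4.\<close>

lemma path_total_approx:
  assumes "set ss \<subseteq> {-1, 1}"
  shows "\<bar>path_total \<beta> ss - 1 / 2 ^ length ss * (1 - 4 * turns ss * q)\<bar>
    \<le> 4 * fact (Suc (length ss)) * (r * q)"
  using assms
proof (induction ss)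
  case Nil
  show ?case using q \<beta>0 by (simp add: path_total_def)
next
  case (Cons s ss)
  have rq: "0 \<le> r * q" using q by auto
  \<comment> \<open>Of the three terms below the cutoff, the constant one is half the previous
    total, the linear one vanishes as \<open>\<beta> 1 = 0\<close>, and
    \<open>\<beta> 2 = - q\<close> gives the last.\<close>
  have tail: "\<bar>path_total \<beta> (s # ss) - (path_total \<beta> ss / 2 - coef \<beta> (s # ss) 2 * q)\<bar>
      \<le> fact (Suc (Suc (length ss))) * (r * q)"
    using path_total_approx_tail[of "s # ss" 3 "r * q"] \<beta>_ge_3 Cons.prems \<beta>0 \<beta>1 \<beta>2
    by (simp add: numeral_3_eq_3 coef_Cons_0 numeral_2_eq_2 del: fact_Suc coef.simps)
  show ?case
  proof (cases ss)
    case Nil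
    then show ?thesis
      using tail \<beta>0 rq by (simp add: path_total_def numeral_2_eq_2)
  next
    case (Cons s' ss')
    let ?f = "fact (Suc (length ss')) :: real"
    have ss: "\<bar>s * s'\<bar> = 1" "set ss' \<subseteq> {-1, 1}" "set ss \<subseteq> {-1, 1}"
      using Cons.prems Cons by auto
    have c2: "coef \<beta> (s # ss) 2 = s * s' * coef \<beta> ss' 0"
      by (simp add: Cons numeral_2_eq_2)
    have "\<bar>coef \<beta> (s # ss) 2 * q - s * s' / 2 ^ length ss' * q\<bar> =
        \<bar>s * s'\<bar> * \<bar>coef \<beta> ss' 0 - 1 / 2 ^ length ss'\<bar> * q"
    proof -
      have "coef \<beta> (s # ss) 2 * q - s * s' / 2 ^ length ss' * q =
          s * s' * (coef \<beta> ss' 0 - 1 / 2 ^ length ss') * q"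
        unfolding c2 by (simp add: algebra_simps)
      then show ?thesis
        using q by (simp only: abs_mult abs_of_nonneg)
    qed
    also have "\<dots> \<le> ?f * q * q"
      using coef_0_approx[OF ss(2)] q ss by (intro mult_right_mono) auto
    also have "\<dots> \<le> ?f * (r * q)"
      unfolding mult.assoc using q by (intro mult_left_mono mult_right_mono) auto
    finally have "\<bar>coef \<beta> (s # ss) 2 * q - s * s' / 2 ^ length ss' * q\<bar> \<le> ?f * (r * q)" .
    moreover have "\<bar>path_total \<beta> ss - 1 / 2 ^ length ss * (1 - 4 * turns ss * q)\<bar>
        \<le> 4 * fact (Suc (length ss)) * (r * q)"
      using Cons.IH ss by simp
    moreover have "?f * (r * q) \<le> fact (Suc (Suc (length ss))) * (r * q)"
      unfolding Cons using rq by (intro mult_right_mono fact_mono) auto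
    moreover have "2 * fact (Suc (length ss)) * (r * q) \<le> fact (Suc (Suc (length ss))) * (r * q)"
      using rq by (intro mult_right_mono) (auto simp: algebra_simps)
    moreover have "1 / 2 ^ length (s # ss) * (1 - 4 * turns (s # ss) * q) =
       (1 / 2 ^ length ss * (1 - 4 * turns ss * q)) / 2 - s * s' / 2 ^ length ss' * q"
      by (simp add: Cons field_simps)
    ultimately show ?thesis
      using tail unfolding length_Cons by (rule approx_combine)
  qed
qed

end

subsection \<open>Bounding the moments by the spectral radius\<close>

text \<open>If one ratio \<open>a (Suc k) / a k\<close> exceeds \<open>\<rho>\<close>, then all later ratios are at least as large.\<close>

lemma log_convex_ratio_bound:
  fixes a :: "nat \<Rightarrow> real"
  assumes a: "\<And>k. a k \<ge> 0" and lc: "\<And>k. (a (Suc k))\<^sup>2 \<le> a k * a (Suc (Suc k))"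
    and bd: "\<And>k. a k \<le> C * \<rho> ^ k" and \<rho>: "\<rho> > 0"
  shows "a (Suc k) \<le> \<rho> * a k"
proof (rule ccontr)
  assume "\<not> ?thesis"
  then have gt: "a (Suc k) > \<rho> * a k" by simp
  have pos: "a k > 0"
  proof (rule ccontr)
    assume "\<not> a k > 0"
    then have "a k = 0" using a[of k] by simp
    then show False using lc[of k] gt by simp
  qed
  define R where "R = a (Suc k) / a k"
  have R: "R > \<rho>" unfolding R_def using gt pos by (simp add: field_simps)
  have step: "a (k + j) > 0 \<and> a (Suc (k + j)) \<ge> R * a (k + j)" for j
  proof (induction j)
    case 0
    then show ?case using pos by (simp add: R_def)
  next
    case (Suc j)
    have 1: "a (Suc (k + j)) > 0"
      using Suc R \<rho> by (meson less_le_trans mult_pos_pos less_trans)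
    have "R * a (Suc (k + j)) * a (k + j) = a (Suc (k + j)) * (R * a (k + j))"
      by simp
    also have "\<dots> \<le> a (Suc (k + j)) * a (Suc (k + j))"
      using Suc 1 by (intro mult_left_mono) auto
    also have "\<dots> \<le> a (Suc (Suc (k + j))) * a (k + j)"
      using lc[of "k + j"] by (simp add: power2_eq_square mult.commute)
    finally show ?case using 1 Suc by simp
  qed
  have lower: "a (k + j) \<ge> R ^ j * a k" for j
  proof (induction j)
    case (Suc j)
    have "R ^ Suc j * a k = R * (R ^ j * a k)" by simp
    also have "\<dots> \<le> R * a (k + j)" using Suc R \<rho> by (intro mult_left_mono) auto
    also have "\<dots> \<le> a (k + Suc j)" using step[of j] by simp
    finally show ?case .
  qed simp
  \<comment> \<open>Growth at rate \<open>R\<close> eventually overtakes the bound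
    \<open>C * \<rho> ^ (k + j)\<close>, whatever \<open>C\<close> is.\<close>
  have "R / \<rho> > 1" using R \<rho> by simp
  then obtain j where j: "C * \<rho> ^ k / a k < (R / \<rho>) ^ j"
    using real_arch_pow by blast
  then have "C * \<rho> ^ (k + j) < R ^ j * a k"
    using pos \<rho> by (simp add: field_simps power_add)
  then show False
    using lower[of j] bd[of "k + j"] by linarith
qed

text \<open>The matrix \<open>B / (r n)\<close> has spectral radius below 1, so its Jordan form
  bounds the entries of all its powers, and \<open>T^k 1 / r^k\<close> is the vector of their row
  sums. \<open>C\<close> may depend on \<open>n\<close> and \<open>B\<close>: the log-convexity
  argument uses only the rate \<open>r\<close>.\<close>

lemma walk_bound:
  assumes B: "B \<in> carrier_mat n n" and n: "n > 0" and r: "r > 0"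
    and sr: "lambda_max B < r * real n"
  obtains C where "\<And>k x. x < n \<Longrightarrow> \<bar>walk n (\<lambda>x y. B $$ (x, y)) k x\<bar> \<le> C * r ^ k"
proof -
  define c where "c = complex_of_real (1 / (r * real n))"
  define M where "M = c \<cdot>\<^sub>m map_mat complex_of_real B"
  have c: "c \<noteq> 0" "norm c = 1 / (r * real n)" using n r by (auto simp: c_def norm_divide norm_mult)
  have Bc: "map_mat complex_of_real B \<in> carrier_mat n n" using B by simp
  have M: "M \<in> carrier_mat n n" using B by (simp add: M_def)
  \<comment> \<open>An eigenvalue of \<open>M\<close> of largest modulus is \<open>c\<close> times
    an eigenvalue of \<open>B\<close>, hence of modulus below 1.\<close>
  obtain a where a: "a \<in> spectrum M" "spectral_radius M = norm a"
    using spectral_radius_mem_max(1)[OF M n] by auto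
  then obtain v where v: "v \<in> carrier_vec n" "v \<noteq> 0\<^sub>v n" "M *\<^sub>v v = a \<cdot>\<^sub>v v"
    using M by (auto simp: spectrum_def eigenvalue_def eigenvector_def)
  have Mv: "(c \<cdot>\<^sub>m map_mat complex_of_real B) *\<^sub>v v =
      c \<cdot>\<^sub>v (map_mat complex_of_real B *\<^sub>v v)"
    using B v(1) by (intro eq_vecI) auto
  have "c \<cdot>\<^sub>v (map_mat complex_of_real B *\<^sub>v v) = a \<cdot>\<^sub>v v"
    using v(3) unfolding M_def Mv .
  then have "(1 / c) \<cdot>\<^sub>v (c \<cdot>\<^sub>v (map_mat complex_of_real B *\<^sub>v v)) = (a / c) \<cdot>\<^sub>v v"
    by (simp add: smult_smult_assoc)
  then have "map_mat complex_of_real B *\<^sub>v v = (a / c) \<cdot>\<^sub>v v"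
    using c by (simp add: smult_smult_assoc)
  then have "a / c \<in> spectrum (map_mat complex_of_real B)"
    using v B by (auto simp: spectrum_def eigenvalue_def eigenvector_def)
  then have "norm (a / c) \<le> lambda_max B"
    unfolding lambda_max_def using spectral_radius_mem_max(2)[OF Bc n] by blast
  then have "norm a * (r * real n) < r * real n"
    using sr c by (simp add: norm_divide)
  then have "spectral_radius M < 1"
    using r n a by simp
  then obtain K where K: "norm_bound (M ^\<^sub>m k) K" for k
    using spectral_radius_jnf_norm_bound_less_1_upper_triangular[OF M] by blast
  have Mk: "M ^\<^sub>m k \<in> carrier_mat n n" for k
    using M by (rule pow_carrier_mat)
  \<comment> \<open>Matrix powers unfold on the right, whereas \<open>walk\<close> applies the
    kernel on the left.\<close>
  have pow: "M ^\<^sub>m Suc k = M * M ^\<^sub>m k" for k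
  proof (induction k)
    case 0
    then show ?case using M by simp
  next
    case (Suc k)
    have "M ^\<^sub>m Suc (Suc k) = (M * M ^\<^sub>m k) * M" using Suc by simp
    also have "\<dots> = M * M ^\<^sub>m Suc k" using assoc_mult_mat[OF M Mk M] by simp
    finally show ?case .
  qed
  let ?w = "walk n (\<lambda>x y. B $$ (x, y))"
  have walk: "complex_of_real (?w k x / r ^ k) = (\<Sum>y<n. (M ^\<^sub>m k) $$ (x, y))" if "x < n" for k x
    using that
  proof (induction k arbitrary: x)
    case 0
    then show ?case using M by (simp add: one_mat_def)
  next
    case (Suc k)
    have "(\<Sum>y<n. (M ^\<^sub>m Suc k) $$ (x, y)) = (\<Sum>y<n. \<Sum>z<n. M $$ (x, z) * (M ^\<^sub>m k) $$ (z, y))"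
      unfolding pow using M Mk[of k] Suc.prems
      by (intro sum.cong) (auto simp: scalar_prod_def lessThan_atLeast0)
    also have "\<dots> = (\<Sum>z<n. M $$ (x, z) * (\<Sum>y<n. (M ^\<^sub>m k) $$ (z, y)))"
      by (subst sum.swap) (simp add: sum_distrib_left)
    also have "\<dots> = (\<Sum>z<n. complex_of_real (B $$ (x, z) / (r * real n) * (?w k z / r ^ k)))"
    proof (intro sum.cong refl)
      fix z assume "z \<in> {..<n}"
      then have z: "z < n" by simp
      have "M $$ (x, z) = complex_of_real (B $$ (x, z) / (r * real n))"
        using Suc.prems z B by (simp add: M_def c_def)
      then show "M $$ (x, z) * (\<Sum>y<n. (M ^\<^sub>m k) $$ (z, y)) =
          complex_of_real (B $$ (x, z) / (r * real n) * (?w k z / r ^ k))"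
        by (simp only: Suc.IH[OF z] of_real_mult)
    qed
    also have "\<dots> = complex_of_real (?w (Suc k) x / r ^ Suc k)"
      unfolding of_real_sum[symmetric] by (simp add: avg_def sum_divide_distrib mult_ac)
    finally show ?case ..
  qed
  have "\<bar>?w k x\<bar> \<le> (real n * K) * r ^ k" if x: "x < n" for k x
  proof -
    have "\<bar>?w k x\<bar> / r ^ k = norm (complex_of_real (?w k x / r ^ k))"
      unfolding norm_of_real using r by (simp add: abs_divide)
    also have "\<dots> \<le> (\<Sum>y<n. norm ((M ^\<^sub>m k) $$ (x, y)))"
      unfolding walk[OF x] by (rule norm_sum)
    also have "\<dots> \<le> (\<Sum>y<n. K)"
      using K[of k] x M by (intro sum_mono) (auto simp: norm_bound_def)
    finally show ?thesis using r by (simp add: field_simps)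
  qed
  then show thesis by (rule that)
qed

section \<open>Gram matrix of the iterates of a skew kernel\<close>

locale skew_kernel =
  fixes n :: nat and B :: "nat \<Rightarrow> nat \<Rightarrow> real"
  assumes n: "n > 0" and skew: "\<And>x y. x < n \<Longrightarrow> y < n \<Longrightarrow> B y x = - B x y"
begin

abbreviation moment :: "nat \<Rightarrow> real" where
  "moment k \<equiv> avg n (walk n B k)"

definition gram :: "nat \<Rightarrow> nat \<Rightarrow> real" where
  "gram i j = avg n (\<lambda>x. walk n B i x * walk n B j x)"

lemma gram_commute: "gram i j = gram j i"
  by (simp add: gram_def mult.commute)

lemma moment_eq_gram: "moment k = gram 0 k"
  by (simp add: gram_def)

text \<open>Skew-symmetry makes \<open>T\<close> skew-adjoint for the averaged inner product. This
  moves a power of \<open>T\<close> from one side to the other at the cost of a sign.\<close>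

lemma gram_Suc: "gram (Suc i) j = - gram i (Suc j)"
proof -
  let ?u = "walk n B"
  have "gram (Suc i) j = avg n (\<lambda>x. avg n (\<lambda>y. ?u j x * (B x y * ?u i y)))"
    unfolding avg_cmult by (simp add: gram_def mult.commute)
  also have "\<dots> = avg n (\<lambda>y. avg n (\<lambda>x. ?u j x * (B x y * ?u i y)))"
    by (rule avg_swap)
  also have "\<dots> = avg n (\<lambda>y. avg n (\<lambda>x. (- ?u i y) * (B y x * ?u j x)))"
  proof (intro avg_cong)
    fix x y assume "y < n" "x < n"
    then show "?u j x * (B x y * ?u i y) = - ?u i y * (B y x * ?u j x)"
      using skew[of y x] by simp
  qed
  also have "\<dots> = avg n (\<lambda>y. (- 1) * (?u i y * ?u (Suc j) y))"
    unfolding avg_cmult[of n "- ?u i _"] by simp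
  also have "\<dots> = - gram i (Suc j)"
    unfolding avg_cmult by (simp add: gram_def)
  finally show ?thesis .
qed

lemma gram_nonneg: "gram k k \<ge> 0"
  by (simp add: gram_def avg_def sum_nonneg)

lemma gram_Cauchy_Schwarz: "(gram i j)\<^sup>2 \<le> gram i i * gram j j"
  using avg_Cauchy_Schwarz[of n "walk n B i" "walk n B j"] by (simp add: gram_def power2_eq_square)

text \<open>The diagonal entries \<open>gram k k\<close> are the log-convex sequence, with geometric
  rate \<open>r\<^sup>2\<close>. Starting from \<open>gram 0 0 = 1\<close> and from
  \<open>gram 1 1 = q\<close>, the ratio bound controls \<open>q\<close> and the later
  entries.\<close>

lemma small_moments_walk:
  assumes r: "0 < r" "r \<le> 1"
    and C: "\<And>k x. x < n \<Longrightarrow> \<bar>walk n B k x\<bar> \<le> C * r ^ k"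
  shows "small_moments moment (gram 1 1) r"
proof -
  have bd: "gram k k \<le> C\<^sup>2 * (r\<^sup>2) ^ k" for k
  proof -
    have "gram k k \<le> avg n (\<lambda>_. C\<^sup>2 * (r\<^sup>2) ^ k)"
      unfolding gram_def
    proof (rule avg_mono)
      fix x assume "x < n"
      then have "\<bar>walk n B k x\<bar>\<^sup>2 \<le> (C * r ^ k)\<^sup>2"
        using C by (intro power_mono) auto
      then show "walk n B k x * walk n B k x \<le> C\<^sup>2 * (r\<^sup>2) ^ k"
        by (simp add: power_mult_distrib power2_eq_square mult_ac)
    qed
    then show ?thesis using n by (simp add: avg_const)
  qed
  \<comment> \<open>Moving one power of \<open>T\<close> across turns
    \<open>gram (Suc k) (Suc k)\<close> into an off-diagonal entry, to which Cauchy-Schwarz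
    applies.\<close>
  have lc: "(gram (Suc k) (Suc k))\<^sup>2 \<le> gram k k * gram (Suc (Suc k)) (Suc (Suc k))" for k
    using gram_Cauchy_Schwarz[of k "Suc (Suc k)"] by (simp add: gram_Suc[of k "Suc k"])
  have ratio: "gram (Suc k) (Suc k) \<le> r\<^sup>2 * gram k k" for k
    using log_convex_ratio_bound[of "\<lambda>k. gram k k", OF gram_nonneg lc bd] r by simp
  have r2: "r\<^sup>2 \<le> 1" using r by (simp add: power_le_one)
  have decr: "gram (Suc (Suc k)) (Suc (Suc k)) \<le> r\<^sup>2 * gram 1 1" for k
  proof (induction k)
    case 0
    then show ?case using ratio[of 1] by simp
  next
    case (Suc k)
    have "r\<^sup>2 * gram (Suc (Suc k)) (Suc (Suc k)) \<le> gram (Suc (Suc k)) (Suc (Suc k))"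
      using r2 by (intro mult_left_le_one_le gram_nonneg) auto
    then show ?case using Suc ratio[of "Suc (Suc k)"] by linarith
  qed
  show ?thesis
  proof
    show "0 \<le> gram 1 1" by (rule gram_nonneg)
    have "gram 1 1 \<le> r\<^sup>2"
      using ratio[of 0] n by (simp add: gram_def avg_const)
    also have "\<dots> \<le> r"
      using r by (simp add: power2_eq_square mult_left_le)
    finally show "gram 1 1 \<le> r" .
    show "r \<le> 1" by fact
    show "moment 0 = 1" using n unfolding moment_eq_gram by (simp add: gram_def avg_const)
    show "moment 1 = 0"
      using gram_Suc[of 0 0] gram_commute[of 0 1] unfolding moment_eq_gram by simp
    show "moment 2 = - gram 1 1"
      using gram_Suc[of 0 1] unfolding moment_eq_gram by (simp add: numeral_2_eq_2)
    fix k :: nat assume "k \<ge> 3"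
    then obtain j where k: "k = Suc (Suc (Suc j))"
      by (metis add_Suc le_Suc_ex numeral_3_eq_3 plus_nat.add_0)
    \<comment> \<open>Moving one \<open>T\<close> to the constant function leaves \<open>T 1\<close>
      on one side and at least \<open>T^2 1\<close> on the other. Their squared norms are
      \<open>q\<close> and at most \<open>r\<^sup>2 * q\<close>, so the bound is linear in
      \<open>q\<close>.\<close>
    have "(moment k)\<^sup>2 = (gram 1 (Suc (Suc j)))\<^sup>2"
      using gram_Suc[of 0 "Suc (Suc j)"] unfolding moment_eq_gram k by simp
    also have "\<dots> \<le> gram 1 1 * gram (Suc (Suc j)) (Suc (Suc j))"
      by (rule gram_Cauchy_Schwarz)
    also have "\<dots> \<le> gram 1 1 * (r\<^sup>2 * gram 1 1)"
      by (intro mult_left_mono decr gram_nonneg)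
    also have "\<dots> = (r * gram 1 1)\<^sup>2"
      by (simp add: power2_eq_square)
    finally show "\<bar>moment k\<bar> \<le> r * gram 1 1"
      using r gram_nonneg[of 1] by (metis abs_le_square_iff abs_of_nonneg less_imp_le mult_nonneg_nonneg)
  qed
qed

end

subsection \<open>Oriented paths\<close>

lemma sum_PiE_insert:
  assumes "x \<notin> S"
  shows "(\<Sum>\<phi>\<in>insert x S \<rightarrow>\<^sub>E T. f \<phi>) = (\<Sum>y\<in>T. \<Sum>\<psi>\<in>S \<rightarrow>\<^sub>E T. f (\<psi>(x := y)))"
  unfolding PiE_insert_eq
  using inj_combinator[OF assms, of "\<lambda>_. T"]
  by (simp add: sum.reindex sum.cartesian_product split_def)

text \<open>The first vertex \<open>x\<close> is pinned to \<open>y\<close> and the rest is summed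
  freely. The induction pins the second vertex to \<open>w\<close> and peels off the first
  edge.\<close>

lemma sum_paths_from:
  assumes "distinct (x # xs)" "length ss = length xs" "n > 0"
  shows "(\<Sum>\<phi>\<in>set xs \<rightarrow>\<^sub>E {..<n}. \<Prod>i<length xs.
      1 / 2 + ss ! i * B ((\<phi>(x := y)) ((x # xs) ! i)) ((\<phi>(x := y)) (xs ! i))) =
    real n ^ length xs * path_fun n B ss y"
  using assms
proof (induction xs arbitrary: x y ss)
  case Nil
  then show ?case by simp
next
  case (Cons z zs)
  obtain s ss' where ss: "ss = s # ss'"
    using Cons.prems(2) by (cases ss) auto
  let ?g = "\<lambda>\<phi> i. 1 / 2 + ss ! i * B ((\<phi>(x := y)) ((x # z # zs) ! i)) ((\<phi>(x := y)) ((z # zs) ! i))"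
  have x: "x \<notin> set (z # zs)"
    using Cons.prems(1) by simp
  have nth: "zs ! i \<noteq> x" "(z # zs) ! i \<noteq> x" if "i < length zs" for i
    using that x nth_mem[of i zs] nth_mem[of i "z # zs"] by auto
  \<comment> \<open>Only the first factor sees the update at \<open>x\<close>, because
    \<open>x\<close> does not occur again on the path.\<close>
  have "(\<Prod>i<length (z # zs). ?g (\<psi>(z := w)) i) = (1 / 2 + s * B y w) * (\<Prod>i<length zs.
      1 / 2 + ss' ! i * B ((\<psi>(z := w)) ((z # zs) ! i)) ((\<psi>(z := w)) (zs ! i)))" for \<psi> w
  proof -
    have "?g (\<psi>(z := w)) 0 = 1 / 2 + s * B y w"
      using x by (auto simp: ss)
    moreover have "?g (\<psi>(z := w)) (Suc i) =
        1 / 2 + ss' ! i * B ((\<psi>(z := w)) ((z # zs) ! i)) ((\<psi>(z := w)) (zs ! i))"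
      if "i < length zs" for i
      using nth[OF that] by (simp only: ss nth_Cons_Suc fun_upd_other not_False_eq_True)
    ultimately show ?thesis
      by (simp only: list.size(4) add_0_right add_Suc_right One_nat_def prod.lessThan_Suc_shift)
        (intro arg_cong2[where f = "(*)"] prod.cong, auto simp only: lessThan_iff)
  qed
  then have "(\<Sum>\<phi>\<in>set (z # zs) \<rightarrow>\<^sub>E {..<n}. \<Prod>i<length (z # zs). ?g \<phi> i) =
    (\<Sum>w<n. (1 / 2 + s * B y w) * (\<Sum>\<psi>\<in>set zs \<rightarrow>\<^sub>E {..<n}. \<Prod>i<length zs.
      1 / 2 + ss' ! i * B ((\<psi>(z := w)) ((z # zs) ! i)) ((\<psi>(z := w)) (zs ! i))))"
    using Cons.prems(1) by (simp only: sum_PiE_insert list.set distinct.simps sum_distrib_left simp_thms)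
  also have "\<dots> = (\<Sum>w<n. (1 / 2 + s * B y w) * (real n ^ length zs * path_fun n B ss' w))"
    using Cons.prems ss by (intro sum.cong refl arg_cong2[where f = "(*)"] Cons.IH) auto
  also have "\<dots> = real n ^ length zs * (\<Sum>w<n. (1 / 2 + s * B y w) * path_fun n B ss' w)"
    by (simp only: sum_distrib_left mult.left_commute)
  also have "\<dots> = real n ^ length (z # zs) * path_fun n B ss y"
    using \<open>n > 0\<close> by (simp add: ss avg_def)
  finally show ?case .
qed

lemma turns_eq_sum: "turns ss = (\<Sum>i<length ss - 1. ss ! i * ss ! Suc i)"
proof (induction ss rule: turns.induct)
  case (1 s s' ss)
  then show ?case by (simp add: sum.lessThan_Suc_shift del: sum.lessThan_Suc)
qed auto

section \<open>Sign sequence of an oriented path\<close>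

locale path_arcs =
  fixes D :: "'a pair_pre_digraph" and xs :: "'a list" and forward :: "nat \<Rightarrow> bool" and m :: nat
  assumes len: "length xs = Suc m" and dist: "distinct xs" and verts: "pverts D = set xs"
    and arcs: "parcs D = {if forward i then (xs ! i, xs ! Suc i) else (xs ! Suc i, xs ! i) | i.
                     Suc i < length xs}"
begin

definition arc :: "nat \<Rightarrow> 'a \<times> 'a" where
  "arc i = (if forward i then (xs ! i, xs ! Suc i) else (xs ! Suc i, xs ! i))"

definition sgns :: "real list" where
  "sgns = map (\<lambda>i. if forward i then 1 else - 1) [0..<m]"

lemma nth_eq: "i \<le> m \<Longrightarrow> j \<le> m \<Longrightarrow> xs ! i = xs ! j \<longleftrightarrow> i = j"
  using dist len by (simp add: nth_eq_iff_index_eq)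

lemma parcs_eq: "parcs D = arc ` {..<m}"
  unfolding arcs len by (auto simp: arc_def)

lemma inj_arc: "inj_on arc {..<m}"
  by (rule inj_onI) (auto simp: arc_def nth_eq split: if_splits)

lemma card_parcs: "card (parcs D) = m"
  by (simp add: parcs_eq card_image inj_arc)

lemma length_sgns: "length sgns = m"
  by (simp add: sgns_def)

lemma two_edge_subpaths_eq:
  "two_edge_subpaths D = (\<lambda>i. {arc i, arc (Suc i)}) ` {..<m - 1}"
proof (intro equalityI subsetI)
  fix p assume "p \<in> two_edge_subpaths D"
  then obtain i j u v w where p: "p = {arc i, arc j}" and uvw: "distinct [u, v, w]"
    and ij: "i < m" "j < m" "arc i \<in> {(u, v), (v, u)}" "arc j \<in> {(v, w), (w, v)}"
    unfolding two_edge_subpaths_def parcs_eq by blast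
  \<comment> \<open>The arcs share \<open>v\<close> and their other ends differ, so they are
    neighbours on the path.\<close>
  have "j = Suc i \<or> i = Suc j"
    using ij uvw by (auto simp: arc_def nth_eq split: if_splits)
  then show "p \<in> (\<lambda>i. {arc i, arc (Suc i)}) ` {..<m - 1}"
    using ij p by (auto simp: insert_commute)
next
  fix p assume "p \<in> (\<lambda>i. {arc i, arc (Suc i)}) ` {..<m - 1}"
  then obtain i where "i < m - 1" and p: "p = {arc i, arc (Suc i)}" by blast
  then have i: "Suc i < m" by simp
  have "distinct [xs ! i, xs ! Suc i, xs ! Suc (Suc i)]"
    using i by (simp add: nth_eq)
  moreover have "arc i \<in> parcs D \<inter> {(xs ! i, xs ! Suc i), (xs ! Suc i, xs ! i)}"
    "arc (Suc i) \<in> parcs D \<inter> {(xs ! Suc i, xs ! Suc (Suc i)), (xs ! Suc (Suc i), xs ! Suc i)}"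
    using i by (auto simp: parcs_eq) (auto simp: arc_def)
  ultimately show "p \<in> two_edge_subpaths D"
    unfolding two_edge_subpaths_def p by blast
qed

lemma P3_signed_count_eq: "of_int (P3_signed_count D) = turns sgns"
proof -
  have "inj_on (\<lambda>i. {arc i, arc (Suc i)}) {..<m - 1}"
  proof (rule inj_onI)
    fix i j assume "i \<in> {..<m - 1}" "j \<in> {..<m - 1}"
      "{arc i, arc (Suc i)} = {arc j, arc (Suc j)}"
    then show "i = j"
      using inj_arc by (auto simp: doubleton_eq_iff inj_on_eq_iff)
  qed
  then have "real_of_int (P3_signed_count D) =
      (\<Sum>i<m - 1. real_of_int (P3_sign {arc i, arc (Suc i)}))"
    by (simp add: P3_signed_count_def two_edge_subpaths_eq sum.reindex)
  \<comment> \<open>The head of one arc is the tail of the other exactly when both have the same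
    direction, that is, when the product of their signs is 1.\<close>
  also have "\<dots> = (\<Sum>i<m - 1. sgns ! i * sgns ! Suc i)"
    by (intro sum.cong) (auto simp: P3_sign_def sgns_def arc_def nth_eq)
  finally show ?thesis
    by (simp add: turns_eq_sum length_sgns)
qed

lemma hom_density_eq:
  assumes n: "n > 0" and A: "\<And>x y. x < n \<Longrightarrow> y < n \<Longrightarrow> A $$ (x, y) = 1 / 2 + B x y"
    and skew: "\<And>x y. x < n \<Longrightarrow> y < n \<Longrightarrow> B y x = - B x y"
  shows "hom_density D n A = path_total (\<lambda>k. avg n (walk n B k)) sgns"
proof -
  obtain x xs' where xs: "xs = x # xs'" and len': "length xs' = m"
    using len by (cases xs) auto
  have xs'_nth: "xs' ! i = xs ! Suc i" for i by (simp add: xs)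
  have x: "x \<notin> set xs'" using dist xs by simp
  let ?g = "\<lambda>\<phi> i. 1 / 2 + sgns ! i * B (\<phi> (xs ! i)) (\<phi> (xs' ! i))"
  have "(\<Prod>(x, y)\<in>parcs D. A $$ (\<phi> x, \<phi> y)) = (\<Prod>i<m. ?g \<phi> i)"
    if \<phi>: "\<phi> \<in> set xs \<rightarrow>\<^sub>E {..<n}" for \<phi>
  proof -
    have "(\<Prod>(x, y)\<in>parcs D. A $$ (\<phi> x, \<phi> y)) = (\<Prod>i<m. case arc i of (x, y) \<Rightarrow> A $$ (\<phi> x, \<phi> y))"
      by (simp add: parcs_eq prod.reindex inj_arc)
    also have "\<dots> = (\<Prod>i<m. ?g \<phi> i)"
    proof (intro prod.cong refl)
      fix i assume "i \<in> {..<m}"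
      then have i: "i < m" "xs ! i \<in> set xs" "xs ! Suc i \<in> set xs"
        using len by auto
      then have "\<phi> (xs ! i) < n" "\<phi> (xs ! Suc i) < n"
        using \<phi> by (auto simp: PiE_iff)
      \<comment> \<open>For a backward arc, skew-symmetry turns reversed arguments into the sign
        \<open>- 1\<close>.\<close>
      then show "(case arc i of (x, y) \<Rightarrow> A $$ (\<phi> x, \<phi> y)) = ?g \<phi> i"
        using i(1) skew[of "\<phi> (xs ! i)" "\<phi> (xs ! Suc i)"]
        by (simp add: arc_def sgns_def A xs'_nth)
    qed
    finally show ?thesis .
  qed
  then have "(\<Sum>\<phi>\<in>pverts D \<rightarrow>\<^sub>E {..<n}. \<Prod>(x, y)\<in>parcs D. A $$ (\<phi> x, \<phi> y)) =
      (\<Sum>\<phi>\<in>insert x (set xs') \<rightarrow>\<^sub>E {..<n}. \<Prod>i<m. ?g \<phi> i)"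
    unfolding verts by (simp add: xs)
  also have "\<dots> = (\<Sum>y<n. real n ^ m * path_fun n B sgns y)"
    unfolding sum_PiE_insert[OF x]
    using sum_paths_from[of x xs' sgns n B] x dist n by (simp add: xs len' length_sgns)
  also have "\<dots> = real n ^ Suc m * avg n (path_fun n B sgns)"
    using n by (simp add: avg_def sum_distrib_left[symmetric])
  finally have "hom_density D n A = avg n (path_fun n B sgns)"
    unfolding hom_density_def verts distinct_card[OF dist] len using n by simp
  then show ?thesis
    by (simp only: avg_path_fun)
qed

text \<open>The witness \<open>q\<close> is \<open>gram 1 1\<close>. Main term and error are both
  proportional to it, so its size does not matter for the sign of the deviation.\<close>

lemma local_expansion:
  assumes n: "n > 0" and B: "B \<in> carrier_mat n n" and wt: "weighted_tournament n A"
    and A: "A = (1 / 2) \<cdot>\<^sub>m all_ones_mat n + B" and r: "0 < r" "r \<le> 1"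
    and lam: "lambda_max B < r * real n"
  obtains q where "q \<ge> 0"
    "\<bar>hom_density D n A - 1 / 2 ^ card (parcs D) * (1 - 4 * of_int (P3_signed_count D) * q)\<bar>
      \<le> 4 * fact (Suc m) * (r * q)"
proof -
  have AB: "A $$ (x, y) = 1 / 2 + B $$ (x, y)" if "x < n" "y < n" for x y
    using that B by (simp add: A all_ones_mat_def)
  have skew: "B $$ (y, x) = - B $$ (x, y)" if "x < n" "y < n" for x y
  proof -
    have "A $$ (x, y) + A $$ (y, x) = 1"
      using wt that by (simp add: weighted_tournament_def)
    then show ?thesis using that by (simp add: AB)
  qed
  interpret skew_kernel n "\<lambda>x y. B $$ (x, y)"
    by unfold_locales (fact n, rule skew)
  obtain C where C: "\<And>k x. x < n \<Longrightarrow> \<bar>walk n (\<lambda>x y. B $$ (x, y)) k x\<bar> \<le> C * r ^ k"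
    using walk_bound[OF B n r(1) lam] by blast
  interpret small_moments moment "gram 1 1" r
    by (rule small_moments_walk[OF r C])
  have "hom_density D n A = path_total moment sgns"
    by (rule hom_density_eq[OF n AB skew])
  moreover have "set sgns \<subseteq> {-1, 1}"
    by (auto simp: sgns_def)
  ultimately show thesis
    using that[OF q(1)] path_total_approx[of sgns]
    by (simp only: length_sgns card_parcs P3_signed_count_eq)
qed


end

theorem theorem3p8:
  fixes D :: "'a pair_pre_digraph"
  assumes "oriented_path D"
  shows "(P3_signed_count D > 0 \<longrightarrow> locally_tournament_anti_Sidorenko D) \<and>
         (P3_signed_count D < 0 \<longrightarrow> locally_tournament_Sidorenko D)"
proof -
  obtain xs forward where "xs \<noteq> []" and xs: "distinct xs" "pverts D = set xs"
    "parcs D = {if forward i then (xs ! i, xs ! Suc i) else (xs ! Suc i, xs ! i) | i.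
                     Suc i < length xs}"
    using assms unfolding oriented_path_def by blast
  then obtain m where "length xs = Suc m"
    by (cases xs) auto
  then interpret path_arcs D xs forward m
    using xs by unfold_locales
  let ?C = "real_of_int (P3_signed_count D)" and ?e = "1 / 2 ^ card (parcs D) :: real"
  \<comment> \<open>With this \<open>r\<close> the error becomes exactly \<open>4 * ?e * q\<close>,
    the size of the main deviation when the signed count is 1 or - 1. Being an integer, a nonzero
    count is at least that large in modulus.\<close>
  define r :: real where "r = ?e / fact (Suc m)"
  have "?e \<le> 1" "(1 :: real) \<le> fact (Suc m)"
    by (simp_all add: fact_ge_1 del: fact_Suc)
  then have "?e \<le> fact (Suc m)"
    by (rule order_trans)
  then have "r \<le> 1"
    unfolding r_def by (subst divide_le_eq_1_pos) (simp_all del: fact_Suc)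
  moreover have "0 < r"
    unfolding r_def by (intro divide_pos_pos) (simp_all del: fact_Suc)
  ultimately have r: "0 < r" "r \<le> 1" by simp_all
  have key: "(?C \<ge> 1 \<longrightarrow> hom_density D n A \<le> ?e) \<and> (?C \<le> - 1 \<longrightarrow> hom_density D n A \<ge> ?e)"
    if H: "n > 0" "B \<in> carrier_mat n n" "weighted_tournament n A"
      "A = (1 / 2) \<cdot>\<^sub>m all_ones_mat n + B" "lambda_max B \<le> r / 2 * real n" for n A B
  proof -
    \<comment> \<open>The radius \<open>r / 2\<close> in the hypothesis provides the strict
      inequality.\<close>
    have "lambda_max B < r * real n"
      by (rule le_less_trans[OF H(5)]) (use r H(1) in simp)
    then obtain q where q: "q \<ge> 0"
      "\<bar>hom_density D n A - ?e * (1 - 4 * ?C * q)\<bar> \<le> 4 * fact (Suc m) * (r * q)"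
      by (rule local_expansion[OF H(1-4) r])
    have "4 * fact (Suc m) * (r * q) = 4 * ?e * q"
      by (simp add: r_def del: fact_Suc)
    with q(2) have "\<bar>hom_density D n A - (?e - ?C * (4 * ?e * q))\<bar> \<le> 4 * ?e * q"
      by (simp add: algebra_simps)
    moreover have "?C \<ge> 1 \<Longrightarrow> ?C * (4 * ?e * q) \<ge> 1 * (4 * ?e * q)"
      "?C \<le> - 1 \<Longrightarrow> ?C * (4 * ?e * q) \<le> (- 1) * (4 * ?e * q)"
      using q(1) by (intro mult_right_mono; simp)+
    ultimately show ?thesis
      by (auto simp: abs_le_iff)
  qed
  have "locally_tournament_anti_Sidorenko D" if "P3_signed_count D > 0"
    unfolding locally_tournament_anti_Sidorenko_def
  proof (intro exI[of _ "r / 2"] conjI allI ballI impI)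
    have "?C \<ge> 1" using that by linarith
    then show "hom_density D n A \<le> ?e" if "n > 0" "B \<in> carrier_mat n n" "weighted_tournament n A"
      "A = (1 / 2) \<cdot>\<^sub>m all_ones_mat n + B" "lambda_max B \<le> r / 2 * real n" for n A B
      using key[OF that] by blast
  qed (use r in simp)
  moreover have "locally_tournament_Sidorenko D" if "P3_signed_count D < 0"
    unfolding locally_tournament_Sidorenko_def
  proof (intro exI[of _ "r / 2"] conjI allI ballI impI)
    have "?C \<le> - 1" using that by linarith
    then show "hom_density D n A \<ge> ?e" if "n > 0" "B \<in> carrier_mat n n" "weighted_tournament n A"
      "A = (1 / 2) \<cdot>\<^sub>m all_ones_mat n + B" "lambda_max B \<le> r / 2 * real n" for n A B
      using key[OF that] by blast
  qed (use r in simp)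
  ultimately show ?thesis by blast
qed

end
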